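(* Let $\mathcal A$ be a unitary operator on $\mathcal H$ (a quantum algorithm without measurements), let $\chi:\mathbb Z\to\{0,1\}$ be a Boolean function, let $a$ be the probability that measuring $\mathcal A|\mathbf 0\rangle$ produces a good state, and let $P\ge 4$ be a power of $2$. Let $\tilde a$ be the (random) output of the quantum amplitude estimation algorithm described in the context, with parameters $\mathcal A,\chi,P$. Then $$|a-\tilde a| < \frac{2\pi}{P}\sqrt a+\frac{\pi^2}{P^2}$$ with probability at least $8/\pi^2$.
   Context: Setting. $\mathcal H$ is the state space of a joint quantum system whose first subsystem has orthonormal basis states $|i\rangle$ indexed by integers $i$; every pure state is a superposition $\sum_{i\in\mathbb Z}x_i|i\rangle|\Upsilon_i\rangle$ with only finitely many nonzero amplitudes $x_i$. $|\mathbf 0\rangle\in\mathcal H$ is the fixed all-zero initial state. Given $\chi:\mathbb Z\to\{0,1\}$, a state $|i\rangle|\cdot\rangle$ is good if $\chi(i)=1$ and bad if $\chi(i)=0$. Write $\mathcal A|\mathbf 0\rangle=|\Psi\rangle=|\Psi^a\rangle+|\Psi^b\rangle$, where $|\Psi^a\rangle$ and $|\Psi^b\rangle$ are the orthogonal projections of $|\Psi\rangle$ onto the span of the good, respectively bad, states; then $a=\langle\Psi^a|\Psi^a\rangle$. Let $\mathbf S_\chi$ be the unitary with $|i\rangle|\cdot\rangle\mapsto(-1)^{\chi(i)}|i\rangle|\cdot\rangle$, let $\mathbf S_0=\mathbf I-2|\mathbf 0\rangle\langle\mathbf 0|$, and let $\mathbf Q=-\mathcal A\,\mathbf S_0\,\mathcal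 A^{-1}\,\mathbf S_\chi$. On $\mathbb C^P\otimes\mathcal H$ define the unitary $\mathbf C:|m\rangle\otimes|\Phi\rangle\mapsto|m\rangle\otimes\mathbf Q^m|\Phi\rangle$ for $0\le m\le P-1$. The quantum Fourier transform on $\mathbb C^P$ is $\mathbf F_P:|k\rangle\mapsto\frac1{\sqrt P}\sum_{l=0}^{P-1}e^{2\pi\mathrm i kl/P}|l\rangle$, and $\mathbf W$ denotes the Walsh--Hadamard transform on $\log_2P$ qubits, so $\mathbf W|0\rangle=\frac1{\sqrt P}\sum_{m=0}^{P-1}|m\rangle$. Algorithm: (1) prepare $|\Psi_0\rangle=\mathbf W|0\rangle\otimes\mathcal A|\mathbf 0\rangle$; (2) apply $\mathbf C$; (3) optionally measure the second register (this does not affect the output distribution); (4) apply $\mathbf F_P\otimes\mathbf I$; (5) measure the first register in the computational basis, obtaining $\tilde f\in\{0,\dots,P-1\}$, and if $\tilde f>P/2$ replace $\tilde f$ by $P-\tilde f$; (6) output $\tilde a=\sin^2(\tilde f\pi/P)$. *)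

theory Defs
  imports "HOL-Probability.Probability" "HOL-Library.Poly_Mapping"
begin

section \<open>Complex inner product spaces\<close>

text \<open>The inner product is conjugate-linear in the first argument (bra-ket convention).\<close>

class complex_inner = ab_group_add +
  fixes scaleC :: "complex \<Rightarrow> 'a \<Rightarrow> 'a" (infixr "*c" 75)
    and cinner :: "'a \<Rightarrow> 'a \<Rightarrow> complex"
  assumes scaleC_add_right: "c *c (x + y) = c *c x + c *c y"
    and scaleC_add_left: "(c + d) *c x = c *c x + d *c x"
    and scaleC_scaleC: "c *c d *c x = (c * d) *c x"
    and scaleC_one: "1 *c x = x"
    and cinner_commute: "cinner x y = cnj (cinner y x)"
    and cinner_add_right: "cinner x (y + z) = cinner x y + cinner x z"
    and cinner_scaleC_right: "cinner x (c *c y) = c * cinner x y"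
    and cinner_ge_zero: "0 \<le> Re (cinner x x)"
    and cinner_eq_zero_iff: "cinner x x = 0 \<longleftrightarrow> x = 0"

lemma vector_space_scaleC:
  "vector_space (scaleC :: complex \<Rightarrow> 'a \<Rightarrow> 'a::complex_inner)"
  by unfold_locales
    (simp_all add: scaleC_add_right scaleC_add_left scaleC_scaleC scaleC_one)

lemma scaleC_zero_right [simp]: "c *c (0::'a::complex_inner) = 0"
  by (rule module.scale_zero_right[OF vector_space_scaleC[unfolded vector_space_def module_def[symmetric]]])

lemma cinner_zero_right [simp]: "cinner x (0::'a::complex_inner) = 0"
  by (metis add_cancel_right_right cinner_add_right)

lemma cinner_zero_left [simp]: "cinner (0::'a::complex_inner) x = 0"
  by (metis cinner_commute cinner_zero_right complex_cnj_zero)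

lemma Im_cinner_self [simp]: "Im (cinner x (x::'a::complex_inner)) = 0"
  by (metis cinner_commute complex_cnj complex.sel(2) complex_surj equal_neg_zero)

definition unitary :: "('a::complex_inner \<Rightarrow> 'a) \<Rightarrow> bool" where
  "unitary U \<longleftrightarrow> Vector_Spaces.linear (*c) (*c) U \<and> surj U
     \<and> (\<forall>x y. cinner (U x) (U y) = cinner x y)"

instantiation complex :: complex_inner
begin
definition scaleC_complex :: "complex \<Rightarrow> complex \<Rightarrow> complex" where
  "scaleC_complex c x = c * x"
definition cinner_complex :: "complex \<Rightarrow> complex \<Rightarrow> complex" where
  "cinner_complex x y = cnj x * y"
instance
  by standard (auto simp: scaleC_complex_def cinner_complex_def algebra_simps)
end

section \<open>Registers\<close>

text \<open>
  The type \<open>'i \<Rightarrow>\<^sub>0 'v\<close> of finitely supported functions is the (algebraic) tensor product of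
  a register with orthonormal basis states indexed by \<open>'i\<close> and of the space \<open>'v\<close>; the vector
  \<open>Poly_Mapping.single i v\<close> is \<open>|i\<rangle> \<otimes> v\<close>. In particular \<open>int \<Rightarrow>\<^sub>0 'b\<close> consists of the
  finite superpositions of the \<open>|i\<rangle>|\<Upsilon>\<^sub>i\<rangle>\<close>. A register of dimension \<open>P\<close>
  is represented by the vectors with support in \<open>{..<P}\<close> of a register indexed by \<open>nat\<close>.
\<close>

instantiation poly_mapping :: (type, complex_inner) complex_inner
begin
definition scaleC_poly_mapping :: "complex \<Rightarrow> ('a \<Rightarrow>\<^sub>0 'b) \<Rightarrow> 'a \<Rightarrow>\<^sub>0 'b" where
  "scaleC_poly_mapping c x = Poly_Mapping.map (scaleC c) x"
definition cinner_poly_mapping :: "('a \<Rightarrow>\<^sub>0 'b) \<Rightarrow> ('a \<Rightarrow>\<^sub>0 'b) \<Rightarrow> complex" where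
  "cinner_poly_mapping x y =
     (\<Sum>i\<in>Poly_Mapping.keys x. cinner (Poly_Mapping.lookup x i) (Poly_Mapping.lookup y i))"
instance
proof
  have lk: "Poly_Mapping.lookup (c *c x) i = c *c Poly_Mapping.lookup x i"
    for c and x :: "'a \<Rightarrow>\<^sub>0 'b" and i
    unfolding scaleC_poly_mapping_def by (transfer) (simp add: when_def)
  have ci: "cinner x y = (\<Sum>i\<in>S. cinner (Poly_Mapping.lookup x i) (Poly_Mapping.lookup y i))"
    if "finite S" "Poly_Mapping.keys x \<subseteq> S" for x y :: "'a \<Rightarrow>\<^sub>0 'b" and S
    unfolding cinner_poly_mapping_def using that
    by (intro sum.mono_neutral_left) (auto simp: in_keys_iff)
  fix c d :: complex and x y z :: "'a \<Rightarrow>\<^sub>0 'b"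
  show "c *c (x + y) = c *c x + c *c y"
    by (intro poly_mapping_eqI) (simp add: lk lookup_add scaleC_add_right)
  show "(c + d) *c x = c *c x + d *c x"
    by (intro poly_mapping_eqI) (simp add: lk lookup_add scaleC_add_left)
  show "c *c d *c x = (c * d) *c x"
    by (intro poly_mapping_eqI) (simp add: lk scaleC_scaleC)
  show "1 *c x = x"
    by (intro poly_mapping_eqI) (simp add: lk scaleC_one)
  show "cinner x y = cnj (cinner y x)"
  proof -
    let ?S = "Poly_Mapping.keys x \<union> Poly_Mapping.keys y"
    have "cinner x y = (\<Sum>i\<in>?S. cinner (Poly_Mapping.lookup x i) (Poly_Mapping.lookup y i))"
      by (rule ci) auto
    also have "\<dots> = cnj (\<Sum>i\<in>?S. cinner (Poly_Mapping.lookup y i) (Poly_Mapping.lookup x i))"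
      unfolding cnj_sum by (intro sum.cong refl) (rule cinner_commute)
    also have "(\<Sum>i\<in>?S. cinner (Poly_Mapping.lookup y i) (Poly_Mapping.lookup x i)) = cinner y x"
      by (rule ci[symmetric]) auto
    finally show ?thesis .
  qed
  show "cinner x (y + z) = cinner x y + cinner x z"
    by (simp add: cinner_poly_mapping_def lookup_add cinner_add_right sum.distrib)
  show "cinner x (c *c y) = c * cinner x y"
    by (simp add: cinner_poly_mapping_def lk cinner_scaleC_right sum_distrib_left)
  show "0 \<le> Re (cinner x x)"
    by (simp add: cinner_poly_mapping_def cinner_ge_zero sum_nonneg)
  show "cinner x x = 0 \<longleftrightarrow> x = 0"
  proof
    assume "cinner x x = 0"
    hence "(\<Sum>i\<in>Poly_Mapping.keys x.
        Re (cinner (Poly_Mapping.lookup x i) (Poly_Mapping.lookup x i))) = 0"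
      by (metis Re_sum cinner_poly_mapping_def zero_complex.sel(1))
    hence 0: "\<forall>i\<in>Poly_Mapping.keys x.
        Re (cinner (Poly_Mapping.lookup x i) (Poly_Mapping.lookup x i)) = 0"
      by (subst (asm) sum_nonneg_eq_0_iff) (auto simp: cinner_ge_zero)
    have "Poly_Mapping.lookup x i = 0" for i
    proof (cases "i \<in> Poly_Mapping.keys x")
      case True
      hence "cinner (Poly_Mapping.lookup x i) (Poly_Mapping.lookup x i) = 0"
        using 0 by (simp add: complex_eq_iff)
      thus ?thesis by (simp add: cinner_eq_zero_iff)
    qed (simp add: in_keys_iff)
    thus "x = 0" by (intro poly_mapping_eqI) simp
  qed (simp add: cinner_poly_mapping_def)
qed
end

lemma lookup_scaleC [simp]:
  "Poly_Mapping.lookup (c *c x) i = c *c Poly_Mapping.lookup x i"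
  unfolding scaleC_poly_mapping_def by transfer (simp add: when_def)

text \<open>The linear map determined by \<open>|i\<rangle> \<otimes> v \<mapsto> f i v\<close>, for \<open>f i\<close> linear.\<close>

definition lin_ext :: "('i \<Rightarrow> 'v \<Rightarrow> 'w) \<Rightarrow> ('i \<Rightarrow>\<^sub>0 'v::zero) \<Rightarrow> 'w::comm_monoid_add" where
  "lin_ext f x = (\<Sum>i\<in>Poly_Mapping.keys x. f i (Poly_Mapping.lookup x i))"

lemma lin_ext_single: "f i 0 = 0 \<Longrightarrow> lin_ext f (Poly_Mapping.single i v) = f i v"
  by (cases "v = 0") (simp_all add: lin_ext_def)

definition ket :: "'i \<Rightarrow> 'i \<Rightarrow>\<^sub>0 complex" where
  "ket i = Poly_Mapping.single i 1"

definition tensor :: "('i \<Rightarrow>\<^sub>0 complex) \<Rightarrow> 'v::complex_inner \<Rightarrow> 'i \<Rightarrow>\<^sub>0 'v" where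
  "tensor u v = lin_ext (\<lambda>i c. Poly_Mapping.single i (c *c v)) u"

definition tensor_id ::
  "(('i \<Rightarrow>\<^sub>0 complex) \<Rightarrow> ('j \<Rightarrow>\<^sub>0 complex)) \<Rightarrow> ('i \<Rightarrow>\<^sub>0 'v::complex_inner) \<Rightarrow> 'j \<Rightarrow>\<^sub>0 'v" where
  "tensor_id T = lin_ext (\<lambda>i v. tensor (T (ket i)) v)"

section \<open>Measurement of a register\<close>

text \<open>Born rule; only meaningful for unit vectors, see \<open>pmf_measure_register\<close> below.\<close>

definition measure_register :: "('i \<Rightarrow>\<^sub>0 'v::complex_inner) \<Rightarrow> 'i pmf" where
  "measure_register x =
     embed_pmf (\<lambda>i. Re (cinner (Poly_Mapping.lookup x i) (Poly_Mapping.lookup x i)))"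

lemma pmf_measure_register:
  fixes x :: "'i \<Rightarrow>\<^sub>0 'v::complex_inner"
  assumes "cinner x x = 1"
  shows "pmf (measure_register x) i = Re (cinner (Poly_Mapping.lookup x i) (Poly_Mapping.lookup x i))"
  unfolding measure_register_def
proof (rule pmf_embed_pmf)
  let ?g = "\<lambda>i. Re (cinner (Poly_Mapping.lookup x i) (Poly_Mapping.lookup x i))"
  show "0 \<le> ?g j" for j by (rule cinner_ge_zero)
  have "(\<integral>\<^sup>+j. ennreal (?g j) \<partial>count_space UNIV) = (\<Sum>j\<in>Poly_Mapping.keys x. ennreal (?g j))"
    by (intro nn_integral_count_space') (auto simp: in_keys_iff)
  also have "\<dots> = ennreal (\<Sum>j\<in>Poly_Mapping.keys x. ?g j)"
    by (intro sum_ennreal) (rule cinner_ge_zero)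
  also have "(\<Sum>j\<in>Poly_Mapping.keys x. ?g j) = Re (cinner x x)"
    unfolding cinner_poly_mapping_def by simp
  finally show "(\<integral>\<^sup>+j. ennreal (?g j) \<partial>count_space UNIV) = 1"
    using assms by simp
qed

section \<open>Amplitude estimation\<close>

definition good_part :: "(int \<Rightarrow> bool) \<Rightarrow> (int \<Rightarrow>\<^sub>0 'b::complex_inner) \<Rightarrow> int \<Rightarrow>\<^sub>0 'b" where
  "good_part chi = lin_ext (\<lambda>i v. if chi i then Poly_Mapping.single i v else 0)"

definition S_chi :: "(int \<Rightarrow> bool) \<Rightarrow> (int \<Rightarrow>\<^sub>0 'b::complex_inner) \<Rightarrow> int \<Rightarrow>\<^sub>0 'b" where
  "S_chi chi = lin_ext (\<lambda>i v. Poly_Mapping.single i (if chi i then - v else v))"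

definition S_zero :: "'h::complex_inner \<Rightarrow> 'h \<Rightarrow> 'h" where
  "S_zero z x = x - (2 * cinner z x) *c z"

definition Q_op ::
  "((int \<Rightarrow>\<^sub>0 'b) \<Rightarrow> (int \<Rightarrow>\<^sub>0 'b)) \<Rightarrow> (int \<Rightarrow> bool) \<Rightarrow> (int \<Rightarrow>\<^sub>0 'b)
     \<Rightarrow> (int \<Rightarrow>\<^sub>0 'b) \<Rightarrow> int \<Rightarrow>\<^sub>0 'b::complex_inner" where
  "Q_op A chi z x = - A (S_zero z (inv A (S_chi chi x)))"

definition controlled :: "('h \<Rightarrow> 'h) \<Rightarrow> (nat \<Rightarrow>\<^sub>0 'h::complex_inner) \<Rightarrow> nat \<Rightarrow>\<^sub>0 'h" where
  "controlled U = lin_ext (\<lambda>m v. Poly_Mapping.single m ((U ^^ m) v))"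

definition qft :: "nat \<Rightarrow> (nat \<Rightarrow>\<^sub>0 complex) \<Rightarrow> nat \<Rightarrow>\<^sub>0 complex" where
  "qft P = lin_ext (\<lambda>k c. \<Sum>l<P. Poly_Mapping.single l
     (c * (1 / complex_of_real (sqrt (real P)))
        * exp (2 * complex_of_real pi * \<i> * of_nat k * of_nat l / of_nat P)))"

text \<open>
  For \<open>P = 2 ^ n\<close>, the \<open>n\<close>-fold tensor power of the Hadamard gate: the sign of the
  \<open>(k, l)\<close> entry is given by the inner product of the binary expansions of \<open>k\<close> and \<open>l\<close>.
\<close>

definition walsh_hadamard :: "nat \<Rightarrow> (nat \<Rightarrow>\<^sub>0 complex) \<Rightarrow> nat \<Rightarrow>\<^sub>0 complex" where
  "walsh_hadamard P = lin_ext (\<lambda>k c. \<Sum>l<P. Poly_Mapping.single l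
     (c * (1 / complex_of_real (sqrt (real P))) * (- 1) ^ card {j. bit k j \<and> bit l j}))"

definition est_amp_state ::
  "((int \<Rightarrow>\<^sub>0 'b) \<Rightarrow> (int \<Rightarrow>\<^sub>0 'b)) \<Rightarrow> (int \<Rightarrow> bool) \<Rightarrow> (int \<Rightarrow>\<^sub>0 'b) \<Rightarrow> nat
     \<Rightarrow> nat \<Rightarrow>\<^sub>0 (int \<Rightarrow>\<^sub>0 'b::complex_inner)" where
  "est_amp_state A chi z P =
     tensor_id (qft P) (controlled (Q_op A chi z) (tensor (walsh_hadamard P (ket 0)) (A z)))"

definition est_amp ::
  "((int \<Rightarrow>\<^sub>0 'b) \<Rightarrow> (int \<Rightarrow>\<^sub>0 'b)) \<Rightarrow> (int \<Rightarrow> bool) \<Rightarrow> (int \<Rightarrow>\<^sub>0 'b::complex_inner) \<Rightarrow> nat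
     \<Rightarrow> real pmf" where
  "est_amp A chi z P =
     map_pmf (\<lambda>f. (sin (real f * pi / real P))\<^sup>2)
       (map_pmf (\<lambda>f. if real f > real P / 2 then P - f else f)
         (measure_register (est_amp_state A chi z P)))"

section \<open>Success probability and initial superposition\<close>

lemma lookup_good_part:
  "Poly_Mapping.lookup (good_part chi x) i = (if chi i then Poly_Mapping.lookup x i else 0)"
proof -
  have "Poly_Mapping.lookup (good_part chi x) i =
      (\<Sum>j\<in>Poly_Mapping.keys x. if j = i then (if chi i then Poly_Mapping.lookup x i else 0) else 0)"
    unfolding good_part_def lin_ext_def lookup_sum
    by (intro sum.cong refl) (auto simp: lookup_single when_def)
  also have "\<dots> = (if chi i then Poly_Mapping.lookup x i else 0)"
    by (auto simp: in_keys_iff)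
  finally show ?thesis .
qed

text \<open>The success probability is the squared norm of the projection onto the good subspace.\<close>

lemma prob_good:
  fixes x :: "int \<Rightarrow>\<^sub>0 'b::complex_inner"
  assumes "cinner x x = 1"
  shows "complex_of_real (measure_pmf.prob (measure_register x) {i. chi i})
           = cinner (good_part chi x) (good_part chi x)"
proof -
  let ?g = "\<lambda>i. cinner (Poly_Mapping.lookup x i) (Poly_Mapping.lookup x i)"
  let ?G = "{i\<in>Poly_Mapping.keys x. chi i}"
  have "measure_pmf.prob (measure_register x) {i. chi i}
      = measure_pmf.prob (measure_register x) ?G"
    by (intro measure_prob_cong_0) (auto simp: pmf_measure_register[OF assms] in_keys_iff)
  also have "\<dots> = (\<Sum>i\<in>?G. Re (?g i))"
    by (subst measure_measure_pmf_finite) (auto simp: pmf_measure_register[OF assms])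
  finally have "complex_of_real (measure_pmf.prob (measure_register x) {i. chi i}) = (\<Sum>i\<in>?G. ?g i)"
    by (simp add: complex_eq_iff)
  also have "\<dots> = cinner (good_part chi x) (good_part chi x)"
  proof -
    have "Poly_Mapping.keys (good_part chi x) = ?G"
      by (auto simp: in_keys_iff lookup_good_part split: if_splits)
    thus ?thesis
      unfolding cinner_poly_mapping_def by (simp add: lookup_good_part)
  qed
  finally show ?thesis .
qed

lemma walsh_hadamard_ket_0:
  "walsh_hadamard P (ket 0)
     = (\<Sum>m<P. Poly_Mapping.single m (1 / complex_of_real (sqrt (real P))))"
  by (simp add: walsh_hadamard_def lin_ext_def ket_def)

end

theory Submission
  imports Defs
begin

text \<open>
  With \<open>a = sin\<^sup>2 \<theta>\<close>, the operator \<open>Q\<close> acts on the plane spanned by the good and the bad part of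
  \<open>\<Psi>\<close> as the rotation by \<open>2\<theta>\<close>. The good and bad amplitudes of \<open>Q\<^sup>m \<Psi>\<close> are thus
  \<open>sin ((2m + 1)\<theta>)\<close> and \<open>cos ((2m + 1)\<theta>)\<close>, and the law of the measured value is the average of two
  Fejer kernels, centred at \<open>f = P\<theta>/\<pi>\<close> and at \<open>-f\<close> modulo \<open>P\<close>. The output depends on the
  measured value only up to sign modulo \<open>P\<close>, so it suffices to consider the first kernel. It gives
  the two integers next to \<open>f\<close> a total mass of at least
  \<open>sin\<^sup>2 (\<pi>d) (1/d\<^sup>2 + 1/(1-d)\<^sup>2) / \<pi>\<^sup>2 \<ge> 8/\<pi>\<^sup>2\<close>, where \<open>d\<close> is the fractional part of \<open>f\<close>,
  and for these integers the angle is off by less than \<open>\<pi>/P\<close>.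
\<close>

section \<open>A trigonometric inequality for the two neighbouring grid points\<close>

text \<open>
  Equality holds at \<open>v = 0\<close> and \<open>\<bar>v\<bar> = 1\<close>; hence the split into Taylor estimates around \<open>0\<close>
  and around \<open>1\<close>.
\<close>

lemma cos_sq_lower_bound:
  fixes v :: real
  assumes "\<bar>v\<bar> \<le> 1"
  shows "(1 - v\<^sup>2)\<^sup>2 \<le> (cos (pi * v / 2))\<^sup>2 * (1 + v\<^sup>2)"
proof -
  have nonneg: "(1 - v\<^sup>2)\<^sup>2 \<le> (cos (pi * v / 2))\<^sup>2 * (1 + v\<^sup>2)" if v: "0 \<le> v" "v \<le> 1" for v :: real
  proof (cases "v \<le> 3/5")
    case True
    define u where "u = v\<^sup>2"
    have u: "0 \<le> u" "u \<le> 9/25"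
      using power_mono[OF True \<open>0 \<le> v\<close>, of 2] by (auto simp: u_def power2_eq_square)
    \<comment> \<open>The decimal lies just below the square root of 9.92 = 8 * 31/25.\<close>
    have "pi\<^sup>2 \<le> 3.1496\<^sup>2"
      by (rule power_mono) (use pi_approx in auto)
    hence pi2: "pi\<^sup>2 / 8 \<le> 31/25"
      by (simp add: power2_eq_square)
    have "cos (pi * v / 2) = 1 - 2 * (sin (pi * v / 4))\<^sup>2"
      using cos_double_sin[of "pi * v / 4"] by (simp add: mult.commute)
    moreover have "(sin (pi * v / 4))\<^sup>2 \<le> (pi * v / 4)\<^sup>2"
      by (metis abs_le_square_iff abs_sin_x_le_abs_x)
    moreover have "2 * (pi * v / 4)\<^sup>2 = pi\<^sup>2 / 8 * u"
      by (simp add: u_def power2_eq_square)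
    moreover have "pi\<^sup>2 / 8 * u \<le> 31/25 * u"
      using pi2 u(1) by (rule mult_right_mono)
    ultimately have "1 - 31/25 * u \<le> cos (pi * v / 2)" by linarith
    moreover have "0 \<le> 1 - 31/25 * u" using u by simp
    ultimately have cos: "(1 - 31/25 * u)\<^sup>2 \<le> (cos (pi * v / 2))\<^sup>2"
      by (rule power_mono)
    \<comment> \<open>With \<open>1 - 31/25 * u\<close> in place of the cosine, the difference of
      the two sides is \<open>u\<close> times a quadratic. Dividing that quadratic by
      \<open>9/25 - u\<close> leaves its value 0.02000896 at \<open>u = 9/25\<close>, the square of
      the split point 3/5.\<close>
    have "0 \<le> u * ((9/25 - u) * (1.388864 - 1.5376 * u) + 0.02000896)"
      using u by (intro mult_nonneg_nonneg add_nonneg_nonneg) auto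
    also have "\<dots> = (1 - 31/25 * u)\<^sup>2 * (1 + u) - (1 - u)\<^sup>2"
      by (simp add: power2_eq_square field_simps)
    finally have "(1 - u)\<^sup>2 \<le> (1 - 31/25 * u)\<^sup>2 * (1 + u)" by simp
    also have "\<dots> \<le> (cos (pi * v / 2))\<^sup>2 * (1 + u)"
      using cos u(1) by (intro mult_right_mono) auto
    finally show ?thesis by (simp add: u_def)
  next
    case False
    define w where "w = 1 - v"
    define x where "x = pi * w / 2"
    have w: "0 \<le> w" "w \<le> 2/5" using False v by (auto simp: w_def)
    have x0: "0 \<le> x" "x \<le> 4/5"
      using w mult_mono[of pi 4 w "2/5"] pi_less_4 by (auto simp: x_def)
    have "cos (pi * v / 2) = sin x"
      unfolding x_def w_def sin_cos_eq by (simp add: algebra_simps diff_divide_distrib)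
    have "\<bar>sin x - x\<bar> \<le> x ^ 3 / 6"
      using Maclaurin_sin_bound[of x 3] x0
      by (simp add: sin_coeff_def numeral_eq_Suc fact_numeral divide_simps)
    hence "x - x ^ 3 / 6 \<le> sin x" by linarith
    have "pi * w \<le> 3.2 * (2/5)"
      using w pi_approx by (intro mult_mono) auto
    hence "x \<le> 0.64" by (simp add: x_def)
    hence "x\<^sup>2 \<le> 0.64\<^sup>2" using x0 by (intro power_mono)
    \<comment> \<open>0.93 is a rounded-down value of \<open>1 - 0.64\<^sup>2 / 6\<close>.\<close>
    hence "x * (93/100) \<le> x * (1 - x\<^sup>2 / 6)"
      using x0(1) by (intro mult_left_mono) (auto simp: power2_eq_square)
    also have "\<dots> = x - x ^ 3 / 6" by (simp add: power2_eq_square power3_eq_cube algebra_simps)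
    also have "\<dots> \<le> sin x" by fact
    finally have "x * (93/100) \<le> sin x" .
    moreover have "3.1 / 2 * w \<le> x"
      unfolding x_def using mult_right_mono[of "3.1" pi w] w pi_approx by simp
    \<comment> \<open>The constant is 0.93 * 3.1 / 2. What matters is that its square exceeds 2, the
      factor spent below on \<open>(1 + v)\<^sup>2 \<le> 2 * (1 + v\<^sup>2)\<close>.\<close>
    ultimately have "(2883/2000) * w \<le> sin x" by linarith
    hence "((2883/2000) * w)\<^sup>2 \<le> (sin x)\<^sup>2" using w by (intro power_mono) auto
    have "(1 - v\<^sup>2)\<^sup>2 = w\<^sup>2 * (1 + v)\<^sup>2"
      by (simp add: w_def power2_eq_square algebra_simps)
    also have "\<dots> \<le> w\<^sup>2 * ((2883/2000)\<^sup>2 * (1 + v\<^sup>2))"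
    proof (rule mult_left_mono)
      have "0 \<le> (1 - v)\<^sup>2" by simp
      hence "(1 + v)\<^sup>2 \<le> 2 * (1 + v\<^sup>2)" by (simp add: power2_eq_square algebra_simps)
      also have "\<dots> \<le> (2883/2000)\<^sup>2 * (1 + v\<^sup>2)" by (rule mult_right_mono) (auto simp: power2_eq_square)
      finally show "(1 + v)\<^sup>2 \<le> (2883/2000)\<^sup>2 * (1 + v\<^sup>2)" .
    qed simp
    also have "\<dots> = ((2883/2000) * w)\<^sup>2 * (1 + v\<^sup>2)" by (simp only: power_mult_distrib mult_ac)
    also have "\<dots> \<le> (sin x)\<^sup>2 * (1 + v\<^sup>2)"
      by (rule mult_right_mono) (fact, simp)
    finally show ?thesis by (simp add: \<open>cos (pi * v / 2) = sin x\<close>)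
  qed
  show ?thesis
  proof (cases "0 \<le> v")
    case False
    thus ?thesis using nonneg[of "- v"] assms by simp
  qed (use nonneg assms in simp)
qed

text \<open>Centring the interval by \<open>v = 1 - 2 * d\<close> turns the sine into
  \<open>cos (pi * v / 2)\<close> and the bracket into
  \<open>8 * (1 + v\<^sup>2) / (1 - v\<^sup>2)\<^sup>2\<close>, so \<open>cos_sq_lower_bound\<close>
  applies. Equality at \<open>d = 1/2\<close> is the origin of the constant 8.\<close>

lemma sin_sq_sum_inverse_squares:
  fixes d :: real
  assumes "0 < d" "d < 1"
  shows "8 \<le> (sin (pi * d))\<^sup>2 * (1 / d\<^sup>2 + 1 / (1 - d)\<^sup>2)"
proof -
  define v where "v = 1 - 2 * d"
  have d: "d = (1 - v) / 2" "1 - d = (1 + v) / 2" by (auto simp: v_def field_simps)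
  have pos: "1 - v > 0" "1 + v > 0" using assms by (auto simp: v_def)
  have "sin (pi * d) = cos (pi * v / 2)"
    unfolding sin_cos_eq v_def by (simp add: algebra_simps diff_divide_distrib)
  have "1 / d\<^sup>2 + 1 / (1 - d)\<^sup>2 = 8 * (1 + v\<^sup>2) / ((1 - v) * (1 + v))\<^sup>2"
    unfolding d using pos by (simp add: power_divide divide_simps) (simp add: power2_eq_square algebra_simps)
  also have "(1 - v) * (1 + v) = 1 - v\<^sup>2" by (simp add: power2_eq_square algebra_simps)
  finally have eq: "1 / d\<^sup>2 + 1 / (1 - d)\<^sup>2 = 8 * (1 + v\<^sup>2) / (1 - v\<^sup>2)\<^sup>2" .
  have "0 < (1 - v) * (1 + v)" using pos by simp
  also have "(1 - v) * (1 + v) = 1 - v\<^sup>2" by (simp add: power2_eq_square algebra_simps)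
  finally have "0 < (1 - v\<^sup>2)\<^sup>2" by simp
  moreover have "8 * (1 - v\<^sup>2)\<^sup>2 \<le> (cos (pi * v / 2))\<^sup>2 * (8 * (1 + v\<^sup>2))"
    using cos_sq_lower_bound[of v] pos by (simp add: abs_le_iff algebra_simps)
  ultimately show ?thesis
    unfolding eq \<open>sin (pi * d) = _\<close> by (simp only: times_divide_eq_right pos_le_divide_eq)
qed

section \<open>The Fejer kernel\<close>

text \<open>This is \<open>P\<close> times the Fejer kernel.\<close>

definition fejer_sum :: "nat \<Rightarrow> real \<Rightarrow> real" where
  "fejer_sum P y = (cmod (\<Sum>m<P. cis (real m * y)))\<^sup>2"

lemma fejer_sum_nonneg: "0 \<le> fejer_sum P y"
  by (simp add: fejer_sum_def)

lemma fejer_sum_0: "fejer_sum P 0 = (real P)\<^sup>2"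
  by (simp add: fejer_sum_def)

lemma fejer_sum_minus: "fejer_sum P (- y) = fejer_sum P y"
proof -
  have "(\<Sum>m<P. cis (real m * (- y))) = cnj (\<Sum>m<P. cis (real m * y))"
    by (simp add: cis_cnj)
  thus ?thesis unfolding fejer_sum_def by (metis complex_mod_cnj)
qed

lemma fejer_sum_periodic: "fejer_sum P (y + 2 * pi) = fejer_sum P y"
proof -
  have "cis (real m * (y + 2 * pi)) = cis (real m * y)" for m
    using cis_multiple_2pi[of "real m"] by (simp add: distrib_left cis_mult[symmetric] mult_ac)
  thus ?thesis by (simp add: fejer_sum_def)
qed

text \<open>The geometric sum telescopes after multiplication by \<open>cis y - 1\<close>, and the
  chord from 1 to \<open>cis t\<close> has length \<open>2 * \<bar>sin (t / 2)\<bar>\<close>.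
  Replacing the sine of \<open>y / 2\<close> by its argument gives the bound; the product form
  avoids dividing by zero at \<open>y = 0\<close>.\<close>

lemma fejer_sum_lower_bound: "(sin (real P * y / 2))\<^sup>2 \<le> fejer_sum P y * (y / 2)\<^sup>2"
proof -
  have norm1: "cmod (cis t - 1) = 2 * \<bar>sin (t / 2)\<bar>" for t
    using dist_exp_i_1[of t] by (simp add: cis_conv_exp)
  have "(cis y - 1) * (\<Sum>m<P. cis (real m * y)) = cis (real P * y) - 1"
    using power_diff_1_eq[of "cis y" P] by (simp add: Complex.DeMoivre)
  hence "cmod (cis y - 1) * cmod (\<Sum>m<P. cis (real m * y)) = cmod (cis (real P * y) - 1)"
    by (metis norm_mult)
  hence "\<bar>sin (real P * y / 2)\<bar> = \<bar>sin (y / 2)\<bar> * cmod (\<Sum>m<P. cis (real m * y))"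
    by (simp add: norm1)
  hence "(sin (real P * y / 2))\<^sup>2 = (sin (y / 2))\<^sup>2 * fejer_sum P y"
    by (metis fejer_sum_def power2_abs power_mult_distrib)
  moreover have "(sin (y / 2))\<^sup>2 \<le> (y / 2)\<^sup>2"
    by (metis abs_le_square_iff abs_sin_x_le_abs_x)
  ultimately show ?thesis
    by (simp add: fejer_sum_nonneg mult.commute mult_left_mono)
qed

text \<open>\<open>d\<close> and \<open>1 - d\<close> are the distances of a point from the integers
  below and above it. Both distances have the same \<open>sin\<^sup>2\<close>, which can be factored
  out of the two bounds.\<close>

lemma fejer_sum_adjacent:
  assumes "P > 0" "0 < d" "d < 1"
  shows "8 / pi\<^sup>2 * (real P)\<^sup>2
           \<le> fejer_sum P (2 * pi * d / P) + fejer_sum P (2 * pi * (1 - d) / P)"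
proof -
  have bound: "(sin (pi * e))\<^sup>2 * ((real P)\<^sup>2 / (pi\<^sup>2 * e\<^sup>2)) \<le> fejer_sum P (2 * pi * e / P)"
    if "0 < e" for e
  proof -
    have "real P * (2 * pi * e / P) / 2 = pi * e" using assms(1) by simp
    hence "(sin (pi * e))\<^sup>2 \<le> fejer_sum P (2 * pi * e / P) * (pi * e / P)\<^sup>2"
      using fejer_sum_lower_bound[of P "2 * pi * e / P"] by simp
    thus ?thesis using that assms(1) by (simp add: power_divide power_mult_distrib field_simps)
  qed
  have "sin (pi * (1 - d)) = sin (pi * d)"
    by (simp add: right_diff_distrib)
  have "8 / pi\<^sup>2 * (real P)\<^sup>2
      \<le> (sin (pi * d))\<^sup>2 * (1 / d\<^sup>2 + 1 / (1 - d)\<^sup>2) / pi\<^sup>2 * (real P)\<^sup>2"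
    by (intro mult_right_mono divide_right_mono sin_sq_sum_inverse_squares assms) auto
  also have "\<dots> = (sin (pi * d))\<^sup>2 * ((real P)\<^sup>2 / (pi\<^sup>2 * d\<^sup>2))
      + (sin (pi * (1 - d)))\<^sup>2 * ((real P)\<^sup>2 / (pi\<^sup>2 * (1 - d)\<^sup>2))"
    unfolding \<open>sin (pi * (1 - d)) = _\<close>
    by (simp only: distrib_left distrib_right add_divide_distrib) (simp add: mult_ac)
  also have "\<dots> \<le> fejer_sum P (2 * pi * d / P) + fejer_sum P (2 * pi * (1 - d) / P)"
    using assms by (intro add_mono bound) auto
  finally show ?thesis .
qed

section \<open>Discrete Fourier analysis modulo \<open>P\<close>\<close>

text \<open>For distinct indices the sum is geometric with ratio a \<open>P\<close>-th root of
  unity, and the ratio is not 1 because \<open>P\<close> cannot divide a nonzero difference smaller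
  than \<open>P\<close> in absolute value.\<close>

lemma dft_orthogonal:
  assumes "m < P" "n < P"
  shows "(\<Sum>l<P. cis (2 * pi * real m * real l / real P) * cnj (cis (2 * pi * real n * real l / real P)))
           = (if m = n then of_nat P else 0)"
proof (cases "m = n")
  case True
  thus ?thesis by (simp add: cis_cnj cis_mult)
next
  case False
  define r where "r = cis (2 * pi * (real m - real n) / real P)"
  have "P > 0" using assms by simp
  have eq: "cis (2 * pi * real m * real l / real P) * cnj (cis (2 * pi * real n * real l / real P)) = r ^ l"
    for l
    by (simp add: r_def Complex.DeMoivre cis_cnj cis_mult algebra_simps diff_divide_distrib)
  have "r ^ P = 1"
    using \<open>P > 0\<close> cis_multiple_2pi[of "real m - real n"] by (simp add: r_def Complex.DeMoivre)
  moreover have "r \<noteq> 1"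
  proof
    assume "r = 1"
    hence "\<exists>k::int. 2 * pi * (real m - real n) / real P = of_int k * 2 * pi"
      using cos_one_2pi_int by (auto simp: r_def complex_eq_iff)
    then obtain k :: int where k: "2 * pi * (real m - real n) / real P = of_int k * 2 * pi" by blast
    hence "(2 * pi) * (real m - real n) = (2 * pi) * (of_int k * real P)"
      using \<open>P > 0\<close> by (simp add: field_simps)
    hence "real m - real n = of_int k * real P" by (subst (asm) mult_left_cancel) auto
    hence "real_of_int (int m - int n) = real_of_int (k * int P)" by simp
    hence "int m - int n = k * int P" by linarith
    hence "int P dvd int m - int n" by simp
    moreover have "\<bar>int m - int n\<bar> < int P" using assms by linarith
    ultimately show False
      using False zdvd_imp_le[of "int P" "\<bar>int m - int n\<bar>"] by auto
  qed
  ultimately show ?thesis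
    using False power_diff_1_eq[of r P] by (simp add: eq)
qed

lemma dft_parseval:
  fixes z :: "nat \<Rightarrow> complex"
  shows "(\<Sum>l<P. (cmod (\<Sum>m<P. cis (2 * pi * real m * real l / real P) * z m))\<^sup>2)
           = real P * (\<Sum>m<P. (cmod (z m))\<^sup>2)"
proof -
  define w where "w m l = cis (2 * pi * real m * real l / real P)" for m l :: nat
  have "complex_of_real (\<Sum>l<P. (cmod (\<Sum>m<P. w m l * z m))\<^sup>2)
      = (\<Sum>l<P. \<Sum>m<P. \<Sum>n<P. (z m * cnj (z n)) * (w m l * cnj (w n l)))"
    by (simp only: of_real_sum of_real_power[symmetric] complex_norm_square cnj_sum complex_cnj_mult sum_product)
      (simp only: mult_ac)
  also have "\<dots> = (\<Sum>m<P. \<Sum>n<P. (z m * cnj (z n)) * (\<Sum>l<P. w m l * cnj (w n l)))"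
    by (subst sum.swap, rule sum.cong[OF refl], subst sum.swap) (simp add: sum_distrib_left)
  also have "\<dots> = (\<Sum>m<P. \<Sum>n<P. (z m * cnj (z n)) * (if m = n then of_nat P else 0))"
    unfolding w_def by (intro sum.cong refl) (simp only: dft_orthogonal lessThan_iff)
  also have "\<dots> = (\<Sum>m<P. of_nat P * (z m * cnj (z m)))"
    by (intro sum.cong refl) (simp add: if_distrib mult_ac cong: if_cong)
  also have "\<dots> = complex_of_real (real P * (\<Sum>m<P. (cmod (z m))\<^sup>2))"
    by (simp add: complex_norm_square[symmetric] sum_distrib_left)
  finally show ?thesis unfolding w_def of_real_eq_iff .
qed

section \<open>Coordinates of the register operators\<close>

interpretation cvs: vector_space "(*c) :: complex \<Rightarrow> 'a \<Rightarrow> 'a::complex_inner"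
  by (rule vector_space_scaleC)

lemma cinner_add_left: "cinner (x + y) z = cinner x z + cinner y (z::'a::complex_inner)"
  by (metis cinner_add_right cinner_commute complex_cnj_add)

lemma cinner_scaleC_left: "cinner (c *c x) y = cnj c * cinner x (y::'a::complex_inner)"
  by (metis cinner_commute cinner_scaleC_right complex_cnj_mult)

lemma lin_ext_superset:
  assumes "finite S" "Poly_Mapping.keys x \<subseteq> S" "\<And>i. f i 0 = 0"
  shows "lin_ext f x = (\<Sum>i\<in>S. f i (Poly_Mapping.lookup x i))"
  unfolding lin_ext_def using assms
  by (intro sum.mono_neutral_left) (auto simp: in_keys_iff)

text \<open>\<open>lin_ext\<close> sums over the support only; off the support the formula rests on
  \<open>g i 0 = 0\<close>.\<close>

lemma lookup_lin_ext_single: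
  assumes "\<And>i. g i 0 = 0"
  shows "Poly_Mapping.lookup (lin_ext (\<lambda>i v. Poly_Mapping.single i (g i v)) x) i
           = g i (Poly_Mapping.lookup x i)"
proof -
  have "Poly_Mapping.lookup (lin_ext (\<lambda>i v. Poly_Mapping.single i (g i v)) x) i
      = (\<Sum>j\<in>Poly_Mapping.keys x. if j = i then g i (Poly_Mapping.lookup x i) else 0)"
    unfolding lin_ext_def lookup_sum
    by (intro sum.cong refl) (auto simp: lookup_single when_def)
  also have "\<dots> = g i (Poly_Mapping.lookup x i)"
    using assms by (auto simp: in_keys_iff)
  finally show ?thesis .
qed

lemma lookup_tensor: "Poly_Mapping.lookup (tensor u v) i = Poly_Mapping.lookup u i *c v"
  unfolding tensor_def by (rule lookup_lin_ext_single) simp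

lemma lookup_S_chi:
  "Poly_Mapping.lookup (S_chi chi x) i
     = (if chi i then - Poly_Mapping.lookup x i else Poly_Mapping.lookup x i)"
  unfolding S_chi_def by (subst lookup_lin_ext_single) auto

lemma lookup_controlled:
  assumes "\<And>m. (U ^^ m) 0 = 0"
  shows "Poly_Mapping.lookup (controlled U x) m = (U ^^ m) (Poly_Mapping.lookup x m)"
  unfolding controlled_def by (rule lookup_lin_ext_single) (rule assms)

lemma lookup_tensor_id:
  assumes "finite S" "Poly_Mapping.keys x \<subseteq> S"
  shows "Poly_Mapping.lookup (tensor_id T x) l
           = (\<Sum>k\<in>S. Poly_Mapping.lookup (T (ket k)) l *c Poly_Mapping.lookup x k)"
proof -
  have "tensor u (0 :: 'v::complex_inner) = 0" for u :: "'i \<Rightarrow>\<^sub>0 complex"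
    by (intro poly_mapping_eqI) (simp add: lookup_tensor)
  hence "tensor_id T x = (\<Sum>k\<in>S. tensor (T (ket k)) (Poly_Mapping.lookup x k))"
    unfolding tensor_id_def using assms by (intro lin_ext_superset) auto
  thus ?thesis by (simp add: lookup_sum lookup_tensor)
qed

lemma lookup_sum_single:
  "Poly_Mapping.lookup (\<Sum>l<P. Poly_Mapping.single l (h l)) i = (if i < (P::nat) then h i else 0)"
proof -
  have "Poly_Mapping.lookup (\<Sum>l<P. Poly_Mapping.single l (h l)) i = (\<Sum>l<P. if l = i then h i else 0)"
    unfolding lookup_sum by (intro sum.cong refl) (auto simp: lookup_single when_def)
  thus ?thesis by simp
qed

lemma lookup_qft_ket:
  "Poly_Mapping.lookup (qft P (ket k)) l
     = (if l < P then 1 / complex_of_real (sqrt (real P)) * cis (2 * pi * real k * real l / real P) else 0)"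
proof -
  have "qft P (ket k) = (\<Sum>l<P. Poly_Mapping.single l
      (1 / complex_of_real (sqrt (real P)) * cis (2 * pi * real k * real l / real P)))"
    unfolding qft_def ket_def by (subst lin_ext_single) (auto simp: cis_conv_exp mult_ac)
  thus ?thesis by (simp add: lookup_sum_single)
qed

section \<open>The rotation in the plane of the good and bad parts\<close>

lemma cinner_good_bad: "cinner (good_part chi x) (x - good_part chi x) = 0"
  unfolding cinner_poly_mapping_def
  by (intro sum.neutral) (auto simp: lookup_good_part lookup_minus)

text \<open>By Pythagoras the bad part has squared norm \<open>1 - a\<close>. Together with
  orthogonality this determines every inner product in the plane.\<close>

lemma cinner_good_bad_span:
  fixes x :: "int \<Rightarrow>\<^sub>0 'b::complex_inner"
  assumes "cinner x x = 1" "cinner (good_part chi x) (good_part chi x) = of_real a"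
  defines "g \<equiv> good_part chi x" and "b \<equiv> x - good_part chi x"
  shows "cinner (c *c g + d *c b) (c' *c g + d' *c b) = cnj c * c' * of_real a + cnj d * d' * (1 - of_real a)"
proof -
  have gb: "cinner g b = 0" "cinner b g = 0" and gg: "cinner g g = of_real a"
    using cinner_good_bad[of chi x] cinner_commute[of b g] assms(2) by (auto simp: g_def b_def)
  have "cinner (g + b) (g + b) = 1" using assms(1) by (simp add: g_def b_def)
  hence "cinner b b = 1 - of_real a"
    by (simp add: cinner_add_left cinner_add_right gb gg algebra_simps)
  thus ?thesis
    by (simp add: cinner_add_left cinner_add_right cinner_scaleC_left cinner_scaleC_right gb gg)
qed

text \<open>An isometry carries the reflection in \<open>z\<close> to the reflection in
  \<open>A z\<close>, since \<open>cinner z (inv A w) = cinner (A z) w\<close>.\<close>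

lemma reflection_conjugate:
  assumes "unitary A"
  shows "A (S_zero z (inv A w)) = w - (2 * cinner (A z) w) *c A z"
proof -
  have lin: "Vector_Spaces.linear (*c) (*c) A" and "surj A"
    and inner: "cinner (A x) (A y) = cinner x y" for x y
    using assms by (auto simp: unitary_def)
  hence w: "A (inv A w) = w" by (simp add: surj_f_inv_f)
  interpret A: Vector_Spaces.linear "(*c)" "(*c)" A by (rule lin)
  show ?thesis
    using inner[of z "inv A w"] by (simp add: S_zero_def A.diff A.scale w)
qed

text \<open>\<open>S_chi\<close> negates the good part, and the conjugated \<open>S_zero\<close>
  reflects in \<open>g + b\<close>. The coordinates refer to the unnormalised \<open>g\<close> and
  \<open>b\<close>, so the rotation matrix appears only after scaling them by the norms of
  \<open>g\<close> and \<open>b\<close>.\<close>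

lemma Q_op_plane:
  fixes A :: "(int \<Rightarrow>\<^sub>0 'b::complex_inner) \<Rightarrow> (int \<Rightarrow>\<^sub>0 'b)"
  assumes "unitary A" "cinner z z = 1"
    and "cinner (good_part chi (A z)) (good_part chi (A z)) = of_real a"
  defines "g \<equiv> good_part chi (A z)" and "b \<equiv> A z - good_part chi (A z)"
  shows "Q_op A chi z (x *c g + y *c b)
     = ((1 - 2 * of_real a) * x + 2 * (1 - of_real a) * y) *c g
       + ((1 - 2 * of_real a) * y - 2 * of_real a * x) *c b"
proof -
  have Az: "A z = g + b" by (simp add: g_def b_def)
  have "cinner (A z) (A z) = 1" using assms by (simp add: unitary_def)
  note span = cinner_good_bad_span[OF this assms(3), folded g_def b_def]
  have "S_chi chi (x *c g + y *c b) = (- x) *c g + y *c b"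
    by (intro poly_mapping_eqI)
      (simp add: lookup_S_chi lookup_add lookup_minus lookup_good_part g_def b_def)
  moreover have "cinner (A z) ((- x) *c g + y *c b) = - x * of_real a + y * (1 - of_real a)"
    using span[of 1 1 "- x" y] by (simp add: Az)
  moreover define t where "t = 2 * (- x * of_real a + y * (1 - of_real a))"
  ultimately have "Q_op A chi z (x *c g + y *c b) = - ((- x) *c g + y *c b - t *c (g + b))"
    using reflection_conjugate[OF assms(1), of z "(- x) *c g + y *c b"] by (simp add: Q_op_def Az)
  also have "\<dots> = (x + t) *c g + (t - y) *c b"
    by (simp add: algebra_simps)
  also have "x + t = (1 - 2 * of_real a) * x + 2 * (1 - of_real a) * y"
    by (simp add: t_def algebra_simps)
  also have "t - y = (1 - 2 * of_real a) * y - 2 * of_real a * x"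
    by (simp add: t_def algebra_simps)
  finally show ?thesis .
qed

text \<open>
  The factors \<open>sin \<theta>\<close> and \<open>cos \<theta>\<close> are kept on the left so that the degenerate cases \<open>a = 0\<close>
  and \<open>a = 1\<close>, where the good or the bad part vanishes, are included.
\<close>

lemma Q_op_power:
  fixes A :: "(int \<Rightarrow>\<^sub>0 'b::complex_inner) \<Rightarrow> (int \<Rightarrow>\<^sub>0 'b)"
  assumes "unitary A" "cinner z z = 1"
    and "cinner (good_part chi (A z)) (good_part chi (A z)) = of_real ((sin \<theta>)\<^sup>2)"
  shows "\<exists>\<alpha> \<beta>. sin \<theta> * \<alpha> = sin ((2 * real m + 1) * \<theta>) \<and> cos \<theta> * \<beta> = cos ((2 * real m + 1) * \<theta>)
    \<and> (\<forall>r. (Q_op A chi z ^^ m) (r *c A z)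
        = (r * of_real \<alpha>) *c good_part chi (A z) + (r * of_real \<beta>) *c (A z - good_part chi (A z)))"
proof (induction m)
  case 0
  show ?case
    by (intro exI[of _ 1]) (simp add: cvs.scale_right_distrib[symmetric])
next
  case (Suc m)
  define g b where "g = good_part chi (A z)" and "b = A z - good_part chi (A z)"
  from Suc obtain \<alpha> \<beta> where s: "sin \<theta> * \<alpha> = sin ((2 * real m + 1) * \<theta>)"
    and c: "cos \<theta> * \<beta> = cos ((2 * real m + 1) * \<theta>)"
    and IH: "\<And>r. (Q_op A chi z ^^ m) (r *c A z) = (r * of_real \<alpha>) *c g + (r * of_real \<beta>) *c b"
    unfolding g_def b_def by blast
  \<comment> \<open>These are the coordinates from \<open>Q_op_plane\<close> with
    \<open>1 - a\<close> written as \<open>(cos \<theta>)\<^sup>2\<close>. Multiplied by sin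
    \<theta> and cos \<theta> respectively, they become the addition theorems for the angle
    2\<theta>.\<close>
  define \<alpha>' \<beta>' where "\<alpha>' = (1 - 2 * (sin \<theta>)\<^sup>2) * \<alpha> + 2 * (cos \<theta>)\<^sup>2 * \<beta>"
    and "\<beta>' = (1 - 2 * (sin \<theta>)\<^sup>2) * \<beta> - 2 * (sin \<theta>)\<^sup>2 * \<alpha>"
  have arg: "(2 * real (Suc m) + 1) * \<theta> = 2 * \<theta> + (2 * real m + 1) * \<theta>"
    by (simp add: algebra_simps)
  have "sin \<theta> * \<alpha>' = sin ((2 * real (Suc m) + 1) * \<theta>)"
    unfolding arg sin_add s[symmetric] c[symmetric] sin_double cos_double_sin \<alpha>'_def
    by (simp add: power2_eq_square algebra_simps)
  moreover have "cos \<theta> * \<beta>' = cos ((2 * real (Suc m) + 1) * \<theta>)"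
    unfolding arg cos_add s[symmetric] c[symmetric] sin_double cos_double_sin \<beta>'_def
    by (simp add: power2_eq_square algebra_simps)
  moreover have "(Q_op A chi z ^^ Suc m) (r *c A z) = (r * of_real \<alpha>') *c g + (r * of_real \<beta>') *c b" for r
    using Q_op_plane[OF assms, folded g_def b_def, of "r * of_real \<alpha>" "r * of_real \<beta>"]
    by (simp add: IH \<alpha>'_def \<beta>'_def cos_squared_eq algebra_simps)
  ultimately show ?case unfolding g_def b_def by blast
qed

section \<open>The law of the measured value\<close>

lemma lookup_est_amp_state:
  assumes "\<And>m. (Q_op A chi z ^^ m) 0 = 0"
  shows "Poly_Mapping.lookup (est_amp_state A chi z P) l =
    (if l < P then \<Sum>m<P. (1 / complex_of_real (sqrt (real P)) * cis (2 * pi * real m * real l / real P))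
        *c (Q_op A chi z ^^ m) ((1 / complex_of_real (sqrt (real P))) *c A z) else 0)"
proof -
  let ?x = "controlled (Q_op A chi z) (tensor (walsh_hadamard P (ket 0)) (A z))"
  have lk: "Poly_Mapping.lookup ?x m =
      (if m < P then (Q_op A chi z ^^ m) ((1 / complex_of_real (sqrt (real P))) *c A z) else 0)" for m
    by (simp add: lookup_controlled assms lookup_tensor walsh_hadamard_ket_0 lookup_sum_single)
  have "Poly_Mapping.keys ?x \<subseteq> {..<P}"
    by (auto simp: in_keys_iff lk split: if_splits)
  thus ?thesis
    unfolding est_amp_state_def by (subst lookup_tensor_id[of "{..<P}"]) (auto simp: lookup_qft_ket lk)
qed

text \<open>With \<open>c\<close> and \<open>s\<close> the cosine and sine sums,
  \<open>c + \<i> * s\<close> and \<open>c - \<i> * s\<close> are, up to a phase, the exponential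
  sums of the two kernels. The parallelogram law does the rest.\<close>

lemma fejer_sum_parallelogram:
  "(cmod (\<Sum>m<P. cis (2 * pi * real m * real l / real P) * of_real (sin ((2 * real m + 1) * \<theta>))))\<^sup>2
   + (cmod (\<Sum>m<P. cis (2 * pi * real m * real l / real P) * of_real (cos ((2 * real m + 1) * \<theta>))))\<^sup>2
   = (fejer_sum P (2 * pi * real l / real P + 2 * \<theta>) + fejer_sum P (2 * pi * real l / real P - 2 * \<theta>)) / 2"
proof -
  define s c :: "real \<Rightarrow> complex" where
    "s t = (\<Sum>m<P. cis (2 * pi * real m * real l / real P) * of_real (sin ((2 * real m + 1) * t)))" and
    "c t = (\<Sum>m<P. cis (2 * pi * real m * real l / real P) * of_real (cos ((2 * real m + 1) * t)))" for t
  have F: "fejer_sum P (2 * pi * real l / real P + 2 * t) = (cmod (c t + \<i> * s t))\<^sup>2" for t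
  proof -
    have "c t + \<i> * s t = (\<Sum>m<P. cis (2 * pi * real m * real l / real P) * cis ((2 * real m + 1) * t))"
      by (simp add: c_def s_def sum_distrib_left sum.distrib[symmetric] cis.ctr complex_eq_iff algebra_simps)
    also have "\<dots> = cis t * (\<Sum>m<P. cis (real m * (2 * pi * real l / real P + 2 * t)))"
      unfolding sum_distrib_left cis_mult by (intro sum.cong refl) (simp add: algebra_simps)
    finally show ?thesis by (simp add: fejer_sum_def norm_mult)
  qed
  \<comment> \<open>Oddness of \<open>s\<close> and evenness of \<open>c\<close> yield the second
    kernel from the first at -\<theta>.\<close>
  have "s (- \<theta>) = - s \<theta>" "c (- \<theta>) = c \<theta>"
    by (simp_all add: s_def c_def sum_negf)
  hence "fejer_sum P (2 * pi * real l / real P - 2 * \<theta>) = (cmod (c \<theta> - \<i> * s \<theta>))\<^sup>2"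
    using F[of "- \<theta>"] by simp
  thus ?thesis
    unfolding s_def[symmetric] c_def[symmetric] F
    by (simp add: cmod_power2) (simp add: power2_eq_square algebra_simps)
qed

text \<open>Parseval for a sequence of \<open>P\<close> unimodular entries; this provides the
  normalisation of the final state.\<close>

lemma sum_fejer_sum:
  "(\<Sum>l<P. fejer_sum P (2 * pi * real l / real P + t)) = (real P)\<^sup>2"
proof -
  have "fejer_sum P (2 * pi * real l / real P + t)
      = (cmod (\<Sum>m<P. cis (2 * pi * real m * real l / real P) * cis (real m * t)))\<^sup>2" for l
    unfolding fejer_sum_def cis_mult by (simp add: algebra_simps)
  thus ?thesis by (simp add: dft_parseval) (simp add: power2_eq_square)
qed

lemma Re_cinner_lookup_est_amp_state:
  fixes A :: "(int \<Rightarrow>\<^sub>0 'b::complex_inner) \<Rightarrow> (int \<Rightarrow>\<^sub>0 'b)"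
  assumes "unitary A" "cinner z z = 1"
    and "cinner (good_part chi (A z)) (good_part chi (A z)) = of_real ((sin \<theta>)\<^sup>2)"
  shows "Re (cinner (Poly_Mapping.lookup (est_amp_state A chi z P) l)
      (Poly_Mapping.lookup (est_amp_state A chi z P) l)) =
    (if l < P then (fejer_sum P (2 * pi * real l / real P + 2 * \<theta>)
      + fejer_sum P (2 * pi * real l / real P - 2 * \<theta>)) / (2 * (real P)\<^sup>2) else 0)"
proof -
  define v where "v = Poly_Mapping.lookup (est_amp_state A chi z P)"
  define g b where "g = good_part chi (A z)" and "b = A z - good_part chi (A z)"
  obtain \<alpha> \<beta> where s: "\<And>m. sin \<theta> * \<alpha> m = sin ((2 * real m + 1) * \<theta>)"
    and c: "\<And>m. cos \<theta> * \<beta> m = cos ((2 * real m + 1) * \<theta>)"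
    and Q: "\<And>m r. (Q_op A chi z ^^ m) (r *c A z) = (r * of_real (\<alpha> m)) *c g + (r * of_real (\<beta> m)) *c b"
    using Q_op_power[OF assms(1-3)] unfolding g_def b_def by metis
  \<comment> \<open>The scalar \<open>r\<close> in \<open>Q_op_power\<close> pays off here:
    \<open>r = 0\<close> shows that the powers fix 0, as \<open>lookup_est_amp_state\<close>
    demands.\<close>
  have zero: "(Q_op A chi z ^^ m) 0 = 0" for m
    using Q[of m 0] by simp
  show ?thesis
  proof (cases "l < P")
    case True
    \<comment> \<open>One factor \<open>k\<close> comes from the Walsh-Hadamard transform and one
      from the Fourier transform.\<close>
    define k where "k = 1 / complex_of_real (sqrt (real P))"
    define w where "w m = cis (2 * pi * real m * real l / real P)" for m :: nat
    define X Y where "X = (\<Sum>m<P. k * w m * (k * of_real (\<alpha> m)))"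
      and "Y = (\<Sum>m<P. k * w m * (k * of_real (\<beta> m)))"
    have k2: "k * k = of_real (1 / real P)"
      by (simp add: k_def of_real_mult[symmetric] del: of_real_mult)
    have "v l = X *c g + Y *c b"
      using True
      by (simp add: v_def lookup_est_amp_state zero Q k_def[symmetric] w_def X_def Y_def
          cvs.scale_sum_left cvs.scale_right_distrib sum.distrib mult_ac)
    moreover have "cinner (A z) (A z) = 1" using assms by (simp add: unitary_def)
    ultimately have "cinner (v l) (v l) = cnj X * X * of_real ((sin \<theta>)\<^sup>2) + cnj Y * Y * (1 - of_real ((sin \<theta>)\<^sup>2))"
      using cinner_good_bad_span[OF _ assms(3), of X Y X Y] by (simp add: g_def b_def)
    also have "\<dots> = of_real ((cmod X)\<^sup>2 * (sin \<theta>)\<^sup>2 + (cmod Y)\<^sup>2 * (cos \<theta>)\<^sup>2)"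
      by (simp only: of_real_add of_real_diff of_real_mult of_real_1 complex_norm_square cos_squared_eq)
        (simp only: mult_ac)
    \<comment> \<open>Moving sin \<theta> inside the norm gives the amplitudes
      \<open>sin ((2m + 1)\<theta>)\<close> without dividing by a possibly zero sin
      \<theta>.\<close>
    also have "(cmod X)\<^sup>2 * (sin \<theta>)\<^sup>2 = (cmod (of_real (sin \<theta>) * X))\<^sup>2"
      by (simp add: norm_mult power_mult_distrib)
    also have "of_real (sin \<theta>) * X = k * k * (\<Sum>m<P. w m * of_real (sin ((2 * real m + 1) * \<theta>)))"
      unfolding X_def s[symmetric] sum_distrib_left by (simp add: mult_ac)
    also have "(cmod Y)\<^sup>2 * (cos \<theta>)\<^sup>2 = (cmod (of_real (cos \<theta>) * Y))\<^sup>2"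
      by (simp add: norm_mult power_mult_distrib)
    also have "of_real (cos \<theta>) * Y = k * k * (\<Sum>m<P. w m * of_real (cos ((2 * real m + 1) * \<theta>)))"
      unfolding Y_def c[symmetric] sum_distrib_left by (simp add: mult_ac)
    finally have "Re (cinner (v l) (v l)) = (1 / real P)\<^sup>2 *
        ((cmod (\<Sum>m<P. w m * of_real (sin ((2 * real m + 1) * \<theta>))))\<^sup>2
          + (cmod (\<Sum>m<P. w m * of_real (cos ((2 * real m + 1) * \<theta>))))\<^sup>2)"
      unfolding k2 norm_mult power_mult_distrib norm_of_real by (simp add: algebra_simps)
    also have "\<dots> = (fejer_sum P (2 * pi * real l / real P + 2 * \<theta>)
      + fejer_sum P (2 * pi * real l / real P - 2 * \<theta>)) / (2 * (real P)\<^sup>2)"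
      unfolding w_def fejer_sum_parallelogram by (simp add: power_divide)
    finally show ?thesis using True by (simp add: v_def)
  qed (simp add: lookup_est_amp_state zero)
qed

text \<open>The unit norm demanded by \<open>pmf_measure_register\<close> is read off from the
  weights: each of the two kernels sums to \<open>P\<^sup>2\<close> over the grid.\<close>

lemma pmf_measure_est_amp_state:
  fixes A :: "(int \<Rightarrow>\<^sub>0 'b::complex_inner) \<Rightarrow> (int \<Rightarrow>\<^sub>0 'b)"
  assumes "unitary A" "cinner z z = 1"
    and "cinner (good_part chi (A z)) (good_part chi (A z)) = of_real ((sin \<theta>)\<^sup>2)" and "P > 0"
  shows "pmf (measure_register (est_amp_state A chi z P)) l =
    (if l < P then (fejer_sum P (2 * pi * real l / real P + 2 * \<theta>)
      + fejer_sum P (2 * pi * real l / real P - 2 * \<theta>)) / (2 * (real P)\<^sup>2) else 0)"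
proof -
  define st where "st = est_amp_state A chi z P"
  note weight = Re_cinner_lookup_est_amp_state[OF assms(1-3), of P, folded st_def]
  have "Poly_Mapping.lookup st l = 0" if "\<not> l < P" for l
    using weight[of l] that Im_cinner_self[of "Poly_Mapping.lookup st l"]
    by (metis cinner_eq_zero_iff complex_eq_iff zero_complex.sel)
  hence "Poly_Mapping.keys st \<subseteq> {..<P}" by (auto simp: in_keys_iff)
  hence "cinner st st = (\<Sum>l<P. cinner (Poly_Mapping.lookup st l) (Poly_Mapping.lookup st l))"
    unfolding cinner_poly_mapping_def by (intro sum.mono_neutral_left) (auto simp: in_keys_iff)
  hence "Re (cinner st st) = (\<Sum>l<P. fejer_sum P (2 * pi * real l / real P + 2 * \<theta>)
      + fejer_sum P (2 * pi * real l / real P + (- 2 * \<theta>))) / (2 * (real P)\<^sup>2)"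
    by (simp add: weight sum_divide_distrib)
  also have "\<dots> = 1"
    using \<open>P > 0\<close> unfolding sum.distrib sum_fejer_sum by simp
  finally have "cinner st st = 1"
    by (simp add: complex_eq_iff)
  thus ?thesis unfolding st_def[symmetric] by (simp add: pmf_measure_register weight)
qed

section \<open>From the angle error to the output error\<close>

text \<open>The sine is 1-Lipschitz, so \<open>e = sin y - sin x\<close> is smaller than \<delta>,
  and the difference of squares is \<open>- e * (2 * sin x + e)\<close>. Strictness is drawn from
  the quadratic term, so it survives \<open>sin x = 0\<close>.\<close>

lemma sin_sq_diff_less:
  fixes x y :: real
  assumes "\<bar>y - x\<bar> < \<delta>" "0 \<le> sin x"
  shows "\<bar>(sin x)\<^sup>2 - (sin y)\<^sup>2\<bar> < 2 * \<delta> * sin x + \<delta>\<^sup>2"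
proof -
  define e where "e = sin y - sin x"
  have "e = 2 * sin ((y - x) / 2) * cos ((y + x) / 2)"
    unfolding e_def by (rule sin_diff_sin)
  hence "\<bar>e\<bar> \<le> 2 * \<bar>sin ((y - x) / 2)\<bar>"
    using mult_left_mono[OF abs_cos_le_one, of "2 * \<bar>sin ((y - x) / 2)\<bar>" "(y + x) / 2"]
    by (simp add: abs_mult)
  also have "\<dots> \<le> \<bar>y - x\<bar>" using abs_sin_x_le_abs_x[of "(y - x) / 2"] by simp
  finally have e: "\<bar>e\<bar> < \<delta>" using assms(1) by simp
  have "(sin x)\<^sup>2 - (sin y)\<^sup>2 = - (e * (2 * sin x + e))"
    by (simp add: e_def power2_eq_square algebra_simps)
  hence "\<bar>(sin x)\<^sup>2 - (sin y)\<^sup>2\<bar> = \<bar>e\<bar> * \<bar>2 * sin x + e\<bar>"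
    by (simp add: abs_mult)
  also have "\<dots> \<le> \<bar>e\<bar> * (2 * sin x + \<bar>e\<bar>)"
    using assms(2) by (intro mult_left_mono) auto
  also have "\<dots> = \<bar>e\<bar> * (2 * sin x) + \<bar>e\<bar> * \<bar>e\<bar>" by (simp add: distrib_left)
  also have "\<dots> < \<delta> * (2 * sin x) + \<delta> * \<delta>"
    using e assms(2) by (intro add_le_less_mono mult_right_mono mult_strict_mono) auto
  finally show ?thesis by (simp add: power2_eq_square)
qed

theorem theorem6:
  fixes A :: "(int \<Rightarrow>\<^sub>0 'b::complex_inner) \<Rightarrow> (int \<Rightarrow>\<^sub>0 'b)"
    and ket_zero :: "int \<Rightarrow>\<^sub>0 'b"
    and chi :: "int \<Rightarrow> bool"
    and a :: real
    and P :: nat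
  assumes "unitary A"
    and "cinner ket_zero ket_zero = 1"
    and "a = measure_pmf.prob (measure_register (A ket_zero)) {i. chi i}"
    and "P \<ge> 4"
    and "\<exists>n. P = 2 ^ n"
  shows "measure_pmf.prob (est_amp A chi ket_zero P)
           {a'. \<bar>a - a'\<bar> < 2 * pi / real P * sqrt a + pi\<^sup>2 / (real P)\<^sup>2}
         \<ge> 8 / pi\<^sup>2"
proof -
  define \<theta> where "\<theta> = arcsin (sqrt a)"
  have a: "0 \<le> sqrt a" "sqrt a \<le> 1" using assms(3) by simp_all
  hence "- 1 \<le> sqrt a" by linarith
  have sin: "sin \<theta> = sqrt a" unfolding \<theta>_def by (rule sin_arcsin) (use a in linarith)+
  have \<theta>: "0 \<le> \<theta>" "\<theta> \<le> pi / 2"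
    using a arcsin_le_arcsin[of 0 "sqrt a"] arcsin_ubound[OF \<open>- 1 \<le> sqrt a\<close>] by (simp_all add: \<theta>_def)
  have a_eq: "a = (sin \<theta>)\<^sup>2" using assms(3) by (simp add: sin)
  have P: "P > 0" using assms(4) by simp
  have "cinner (A ket_zero) (A ket_zero) = 1" using assms(1,2) by (simp add: unitary_def)
  hence good: "cinner (good_part chi (A ket_zero)) (good_part chi (A ket_zero)) = of_real ((sin \<theta>)\<^sup>2)"
    by (simp add: prob_good[symmetric] assms(3)[symmetric] a_eq[symmetric] del: of_real_power)
  define M where "M = measure_register (est_amp_state A chi ket_zero P)"
  define E where "E l = fejer_sum P (2 * pi * real l / real P - 2 * \<theta>)" for l
  define E' where "E' l = fejer_sum P (2 * pi * real l / real P + 2 * \<theta>)" for l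
  have pmf: "pmf M l = (if l < P then (E' l + E l) / (2 * (real P)\<^sup>2) else 0)" for l
    using pmf_measure_est_amp_state[OF assms(1,2) good P] by (simp add: M_def E_def E'_def)

  define S where "S = {a'. \<bar>a - a'\<bar> < 2 * pi / real P * sqrt a + pi\<^sup>2 / (real P)\<^sup>2}"
  define out where "out l = (sin (real l * pi / real P))\<^sup>2" for l
  define T where "T = {l. l < P \<and> out l \<in> S}"
  have "finite T" by (simp add: T_def)
  have out_reflect: "out (P - l) = out l" if "l \<le> P" for l
  proof -
    have "real (P - l) * pi / real P = pi - real l * pi / real P"
      using that P by (simp add: of_nat_diff field_simps)
    thus ?thesis by (simp add: out_def)
  qed

  \<comment> \<open>Negation modulo \<open>P\<close> preserves \<open>T\<close>, since it preserves
    the output, and exchanges the two kernels. Index 0 is its own negative and is treated apart, as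
    \<open>P - 0\<close> lies outside the range.\<close>
  have "(\<Sum>l\<in>T. E' l) = (\<Sum>l\<in>T. E l)"
  proof (rule sum.reindex_bij_witness[where i = "\<lambda>l. if l = 0 then 0 else P - l"
        and j = "\<lambda>l. if l = 0 then 0 else P - l"])
    fix l assume "l \<in> T"
    show "E (if l = 0 then 0 else P - l) = E' l"
    proof (cases "l = 0")
      case True
      thus ?thesis using fejer_sum_minus[of P "2 * \<theta>"] by (simp add: E_def E'_def)
    next
      case False
      have "2 * pi * real (P - l) / real P - 2 * \<theta> = - (2 * pi * real l / real P + 2 * \<theta>) + 2 * pi"
        using \<open>l \<in> T\<close> P by (simp add: T_def of_nat_diff field_simps)
      thus ?thesis using False
        by (simp only: E_def E'_def if_False fejer_sum_periodic fejer_sum_minus)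
    qed
  qed (auto simp: T_def out_reflect split: if_splits)
  hence prob_T: "measure_pmf.prob M T = (\<Sum>l\<in>T. E l) / (real P)\<^sup>2"
    using \<open>finite T\<close>
    by (simp add: measure_measure_pmf_finite pmf T_def sum_divide_distrib[symmetric] sum.distrib)

  \<comment> \<open>\<open>f\<close> is the position of \<theta> on the grid of angles
    \<open>l * pi / P\<close>. As \<theta> is at most pi/2, \<open>f\<close> is at most
    \<open>P / 2\<close>, so with \<open>P \<ge> 4\<close> both neighbours \<open>n\<close> and
    \<open>n + 1\<close> stay below \<open>P\<close>.\<close>
  define f where "f = real P * \<theta> / pi"
  define n where "n = nat \<lfloor>f\<rfloor>"
  define d where "d = f - real n"
  have f: "0 \<le> f" "f \<le> real P / 2" using \<theta> mult_left_mono[OF \<theta>(2), of "real P"] by (simp_all add: f_def field_simps)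
  have d: "0 \<le> d" "d < 1" using f(1) by (simp_all add: d_def n_def) linarith
  have "real n \<le> real P / 2" using f d by (simp add: d_def)
  hence "n + 1 < P" using assms(4) by linarith
  have inT: "l \<in> T" if "l < P" "\<bar>real l - f\<bar> < 1" for l
  proof -
    have "real l * pi / real P - \<theta> = (real l - f) * (pi / real P)"
      using P by (simp add: f_def field_simps)
    hence "\<bar>real l * pi / real P - \<theta>\<bar> = \<bar>real l - f\<bar> * (pi / real P)"
      by (simp add: abs_mult)
    also have "\<dots> < pi / real P" using mult_strict_right_mono[OF that(2), of "pi / real P"] P by simp
    finally show ?thesis
      using sin_sq_diff_less[of "real l * pi / real P" \<theta> "pi / real P"] a(1) that(1)
      by (simp add: T_def S_def out_def a_eq[symmetric] sin power_divide mult_ac)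
  qed
  have E_alt: "E l = fejer_sum P (2 * pi * (real l - f) / P)" for l
    using P by (simp add: E_def f_def algebra_simps diff_divide_distrib)
  have "8 / pi\<^sup>2 * (real P)\<^sup>2 \<le> (\<Sum>l\<in>T. E l)"
  \<comment> \<open>For integral \<open>f\<close> the point \<open>n + 1\<close> is at distance
    exactly 1 and may miss \<open>T\<close>, but \<open>n\<close> alone carries the full mass
    \<open>P\<^sup>2\<close>.\<close>
  proof (cases "d = 0")
    case True
    have "3\<^sup>2 \<le> pi\<^sup>2" using pi_gt3 by (intro power_mono) auto
    hence "8 / pi\<^sup>2 * (real P)\<^sup>2 \<le> 1 * (real P)\<^sup>2" by (intro mult_right_mono) auto
    also have "\<dots> = (\<Sum>l\<in>{n}. E l)" using True by (simp add: E_alt d_def fejer_sum_0)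
    also have "\<dots> \<le> (\<Sum>l\<in>T. E l)"
      using True \<open>n + 1 < P\<close> \<open>finite T\<close>
      by (intro sum_mono2) (auto simp: E_def fejer_sum_nonneg d_def intro!: inT)
    finally show ?thesis .
  next
    case False
    have "8 / pi\<^sup>2 * (real P)\<^sup>2 \<le> fejer_sum P (2 * pi * d / P) + fejer_sum P (2 * pi * (1 - d) / P)"
      using fejer_sum_adjacent[OF P, of d] False d by simp
    also have "\<dots> = (\<Sum>l\<in>{n, n + 1}. E l)"
      using fejer_sum_minus[of P "2 * pi * d / P"] by (simp add: E_alt d_def algebra_simps minus_divide_left)
    also have "\<dots> \<le> (\<Sum>l\<in>T. E l)"
      using False d \<open>n + 1 < P\<close> \<open>finite T\<close>
      by (intro sum_mono2) (auto simp: E_def fejer_sum_nonneg d_def intro!: inT)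
    finally show ?thesis .
  qed
  hence "8 / pi\<^sup>2 \<le> measure_pmf.prob M T"
    using P by (simp add: prob_T pos_le_divide_eq)
  \<comment> \<open>Folding \<open>l\<close> to \<open>P - l\<close> leaves \<open>out\<close>
    unchanged, so every element of \<open>T\<close> still yields an output in
    \<open>S\<close>.\<close>
  also have "\<dots> \<le> measure_pmf.prob M ((\<lambda>l. out (if real l > real P / 2 then P - l else l)) -` S)"
    by (intro measure_pmf.finite_measure_mono) (auto simp: T_def out_reflect)
  also have "\<dots> = measure_pmf.prob (est_amp A chi ket_zero P) S"
    by (simp add: est_amp_def M_def out_def map_pmf_comp o_def)
  finally show ?thesis by (simp add: S_def)
qed

end
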